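(* Let $\mathbb{K}$ be a field, $c\in\mathbb{N}$ and $R=\mathbb{K}[x_{i,j}\mid 1\le i\le c,\ j\in\mathbb{N}]$. Let $J$ be an ideal of $R$ satisfying $\mathrm{Inc}(\mathbb{N})\cdot J\subseteq J$. Then $J$ has only finitely many initial ideals with respect to $\mathrm{Inc}(\mathbb{N})$-compatible term orders on $R$; that is, the set $\{\mathrm{in}_\preceq(J)\mid\ \preceq\text{ an }\mathrm{Inc}(\mathbb{N})\text{-compatible term order on }R\}$ is finite.
   Context: $\mathbb{N}=\{1,2,3,\dots\}$. $\mathrm{Inc}(\mathbb{N})$ is the monoid of strictly increasing functions $p:\mathbb{N}\to\mathbb{N}$; it acts on $R$ by $\mathbb{K}$-linear extension of $p\cdot(x_{i_1,j_1}^{e_1}\cdots x_{i_r,j_r}^{e_r})=x_{i_1,p(j_1)}^{e_1}\cdots x_{i_r,p(j_r)}^{e_r}$, and $\mathrm{Inc}(\mathbb{N})\cdot J=\{p\cdot f\mid p\in\mathrm{Inc}(\mathbb{N}),f\in J\}$. A term order $\preceq$ on $R$ is a total order on the monomials of $R$ that respects multiplication and satisfies $1\preceq f$ for every monomial $f$. It is $\mathrm{Inc}(\mathbb{N})$-compatible if $f\preceq g$ implies $p\cdot f\preceq p\cdot g$ for all monomials $f,g\in R$ and all $p\in\mathrm{Inc}(\mathbb{N})$. $\mathrm{in}_\preceq(f)$ denotes the leading (i.e. $\preceq$-largest) monomial of a nonzero polynomial $f$, and $\mathrm{in}_\preceq(J)$ is the ideal of $R$ generated by the leading monomials of the nonzero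 elements of $J$. *)

theory Defs
  imports Complex_Main "HOL-Library.Poly_Mapping"
begin

text \<open>
  The variables of the ring are indexed by \<open>'c \<times> nat\<close>: the finite type \<open>'c\<close> stands for the row
  indices (so \<open>c\<close> is \<open>CARD('c)\<close>, an arbitrary positive number), and \<open>nat\<close> stands for the column
  indices \<open>1, 2, 3, \<dots>\<close>, shifted by one so as to start at \<open>0\<close>.
  A monomial is given by its finitely supported exponent vector, so that addition of exponent
  vectors is multiplication of monomials and \<open>0\<close> is the monomial \<open>1\<close>.
\<close>

type_synonym 'c monom = "('c \<times> nat) \<Rightarrow>\<^sub>0 nat"
type_synonym ('c, 'k) poly_ring = "'c monom \<Rightarrow>\<^sub>0 'k"

text \<open>
  A commutative ring is a module over itself; its submodules are its ideals, and spans are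
  generated ideals.
\<close>

lemma module_times: "module ((*) :: 'a::comm_ring_1 \<Rightarrow> 'a \<Rightarrow> 'a)"
  by unfold_locales (simp_all add: algebra_simps)

abbreviation is_ideal :: "'a::comm_ring_1 set \<Rightarrow> bool"
  where "is_ideal \<equiv> module.subspace (*)"

abbreviation ideal_generated :: "'a::comm_ring_1 set \<Rightarrow> 'a set"
  where "ideal_generated \<equiv> module.span (*)"

definition inc :: "(nat \<Rightarrow> nat) set"
  where "inc = {p. strict_mono p}"

definition inc_monom :: "(nat \<Rightarrow> nat) \<Rightarrow> 'c monom \<Rightarrow> 'c monom"
  where "inc_monom p m = (\<Sum>(i, j)\<in>Poly_Mapping.keys m. Poly_Mapping.single (i, p j) (Poly_Mapping.lookup m (i, j)))"

definition inc_poly :: "(nat \<Rightarrow> nat) \<Rightarrow> ('c, 'k::comm_ring_1) poly_ring \<Rightarrow> ('c, 'k) poly_ring"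
  where "inc_poly p f = (\<Sum>m\<in>Poly_Mapping.keys f. Poly_Mapping.single (inc_monom p m) (Poly_Mapping.lookup f m))"

text \<open>A pair \<open>(f, g)\<close> in the relation \<open>ord\<close> means that \<open>f\<close> is at most \<open>g\<close>.\<close>

definition term_order :: "'c monom rel \<Rightarrow> bool"
  where "term_order ord \<longleftrightarrow>
    linear_order ord \<and>
    (\<forall>f g h. (f, g) \<in> ord \<longrightarrow> (f + h, g + h) \<in> ord) \<and>
    (\<forall>f. (0, f) \<in> ord)"

definition inc_compatible :: "'c monom rel \<Rightarrow> bool"
  where "inc_compatible ord \<longleftrightarrow>
    (\<forall>p\<in>inc. \<forall>f g. (f, g) \<in> ord \<longrightarrow> (inc_monom p f, inc_monom p g) \<in> ord)"

definition leading_monom :: "'c monom rel \<Rightarrow> ('c, 'k::comm_ring_1) poly_ring \<Rightarrow> 'c monom"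
  where "leading_monom ord f = (THE m. m \<in> Poly_Mapping.keys f \<and> (\<forall>n\<in>Poly_Mapping.keys f. (n, m) \<in> ord))"

definition initial_ideal ::
    "'c monom rel \<Rightarrow> ('c, 'k::comm_ring_1) poly_ring set \<Rightarrow> ('c, 'k) poly_ring set"
  where "initial_ideal ord J =
    ideal_generated {Poly_Mapping.single (leading_monom ord f) 1 | f. f \<in> J \<and> f \<noteq> 0}"

end

theory Submission
  imports Defs "HOL-Library.Sublist"
begin

text \<open>
  A compatible term order need not be a well-order (take the lexicographic order with
  \<open>x\<^sub>1 > x\<^sub>2 > \<dots>\<close>), so normal forms modulo \<open>J\<close> may fail to exist. They do exist in the
  subring \<open>R\<^sub>n\<close> of polynomials in the first \<open>n\<close> columns, so we record, for each order, the set of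
  pairs \<open>(n, m)\<close> such that \<open>m\<close> is a leading monomial of an element of \<open>J \<inter> R\<^sub>n\<close>. It determines the
  initial ideal, and it is upward closed for the embedding order on words over \<open>\<nat>\<^sup>c\<close>, a
  well-quasi-order by Higman's lemma. If infinitely many such sets arose, let \<open>I\<close> be a maximal
  upward closed set contained in infinitely many of them, let \<open>(n, m)\<close> lie in one of these but not
  in \<open>I\<close>, and let \<open>f \<in> J \<inter> R\<^sub>n\<close> be \<open>m\<close> minus its normal form. No monomial of \<open>f\<close> lies in \<open>I\<close>, yet
  for every order one of them is leading; by the pigeonhole principle infinitely many of the sets
  share one of them, and \<open>I\<close> was not maximal.
\<close>

section \<open>Well-quasi-orders\<close>

text \<open>A monotone subsequence that is not increasing is decreasing, and a decreasing sequence
  in \<open>nat\<close> is constant once it attains its minimum.\<close>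

lemma mono_subsequence_nat:
  fixes f :: "nat \<Rightarrow> nat"
  shows "\<exists>s :: nat \<Rightarrow> nat. strict_mono s \<and> mono (f \<circ> s)"
proof -
  obtain s :: "nat \<Rightarrow> nat" where s: "strict_mono s" and ms: "monoseq (\<lambda>n. f (s n))"
    using seq_monosub by blast
  show ?thesis
  proof (cases "incseq (\<lambda>n. f (s n))")
    case True
    then show ?thesis using s by (intro exI[of _ s]) (simp add: o_def)
  next
    case False
    then have dec: "decseq (\<lambda>n. f (s n))" using ms by (simp add: monoseq_iff)
    obtain N where N: "\<And>n. f (s N) \<le> f (s n)"
      using ex_has_least_nat[of "\<lambda>_. True" 0 "\<lambda>n. f (s n)"] by auto
    have "f (s (N + n)) = f (s N)" for n
      using decseqD[OF dec, of N "N + n"] N[of "N + n"] by simp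
    then have "mono (f \<circ> (\<lambda>n. s (N + n)))" by (simp add: mono_def)
    moreover have "strict_mono (\<lambda>n. s (N + n))" using s by (simp add: strict_mono_def)
    ultimately show ?thesis by blast
  qed
qed

text \<open>The sequence is thinned out one coordinate at a time. A whole increasing subsequence is
  produced instead of a single pair because \<open>higman\<close> asks this of its alphabet.\<close>

lemma dickson:
  fixes f :: "nat \<Rightarrow> 'a \<Rightarrow> nat"
  assumes "finite A"
  shows "\<exists>s :: nat \<Rightarrow> nat. strict_mono s \<and> (\<forall>i j. i < j \<longrightarrow> (\<forall>x\<in>A. f (s i) x \<le> f (s j) x))"
  using assms
proof induction
  case empty
  show ?case by (intro exI[of _ "\<lambda>n::nat. n"]) (simp add: strict_mono_def)
next
  case (insert a A)
  then obtain s :: "nat \<Rightarrow> nat" where s: "strict_mono s"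
      "\<And>i j. i < j \<Longrightarrow> (\<forall>x\<in>A. f (s i) x \<le> f (s j) x)" by blast
  obtain t :: "nat \<Rightarrow> nat" where t: "strict_mono t" "mono ((\<lambda>n. f (s n) a) \<circ> t)"
    using mono_subsequence_nat by blast
  show ?case
  proof (intro exI conjI allI impI)
    show "strict_mono (s \<circ> t)" using s(1) t(1) by (simp add: strict_mono_def)
    fix i j :: nat assume "i < j"
    then have "t i < t j" using t(1) by (simp add: strict_mono_def)
    then show "\<forall>x\<in>insert a A. f ((s \<circ> t) i) x \<le> f ((s \<circ> t) j) x"
      using s(2) monoD[OF t(2), of i j] \<open>i < j\<close> by simp
  qed
qed

text \<open>Nash-Williams' minimal bad sequence argument.\<close>

lemma higman:
  fixes f :: "nat \<Rightarrow> 'a list"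
  assumes P: "\<And>g :: nat \<Rightarrow> 'a.
    \<exists>s :: nat \<Rightarrow> nat. strict_mono s \<and> (\<forall>i j. i < j \<longrightarrow> P (g (s i)) (g (s j)))"
  shows "\<exists>i j. i < j \<and> list_emb P (f i) (f j)"
proof (rule ccontr)
  define bad where "bad \<equiv> \<lambda>f :: nat \<Rightarrow> 'a list. \<forall>i j. i < j \<longrightarrow> \<not> list_emb P (f i) (f j)"
  define least where "least \<equiv> \<lambda>n x. bad x \<and>
    (\<forall>g. bad g \<longrightarrow> (\<forall>i<n. g i = x i) \<longrightarrow> length (x n) \<le> length (g n))"
  assume "\<not> ?thesis"
  then have "bad f" by (auto simp: bad_def)
  have least_exists: "\<exists>y. least n y \<and> (\<forall>i<n. y i = x i)" if "bad x" for n x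
    using ex_has_least_nat[of "\<lambda>g. bad g \<and> (\<forall>i<n. g i = x i)" x "\<lambda>g. length (g n)"] that
    unfolding least_def by force
  \<comment> \<open>Each \<open>F n\<close> is bad and has a shortest possible entry at
    \<open>n\<close>; passing to \<open>F (Suc n)\<close> freezes the entries up to
    \<open>n\<close>. The diagonal \<open>m\<close> therefore agrees with every \<open>F n\<close>
    up to entry \<open>n\<close> and is bad as well.\<close>
  have "\<exists>F. \<forall>n. least n (F n) \<and> (\<forall>i<Suc n. F (Suc n) i = F n i)"
  proof (rule dependent_nat_choice)
    show "\<exists>x. least 0 x" using least_exists[OF \<open>bad f\<close>] by blast
    show "\<exists>y. least (Suc n) y \<and> (\<forall>i<Suc n. y i = x i)" if "least n x" for x n
      using least_exists[of x "Suc n"] that by (simp add: least_def)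
  qed
  then obtain F where F: "\<And>n. least n (F n)" "\<And>n i. i < Suc n \<Longrightarrow> F (Suc n) i = F n i"
    by blast
  define m where "m n = F n n" for n
  have Fm: "F (i + k) i = m i" for i k
    by (induction k) (simp_all add: m_def F(2))
  then have Fm: "F n i = m i" if "i \<le> n" for i n
    using that by (metis le_add_diff_inverse)
  have bad_m: "\<not> list_emb P (m i) (m j)" if "i < j" for i j
  proof -
    have "bad (F j)" using F(1)[of j] by (simp add: least_def)
    then show ?thesis
      using that Fm[of i j] Fm[of j j] unfolding bad_def by (metis less_imp_le order_refl)
  qed
  have ne: "m i \<noteq> []" for i using bad_m[of i "Suc i"] by auto
  then have m_Cons: "m i = hd (m i) # tl (m i)" for i by simp
  obtain s :: "nat \<Rightarrow> nat" where s: "strict_mono s" and Ps: "\<And>i j. i < j \<Longrightarrow> P (hd (m (s i))) (hd (m (s j)))"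
    using P[of "\<lambda>i. hd (m i)"] by blast
  \<comment> \<open>Tails along \<open>s\<close> replace \<open>m\<close> from position
    \<open>s 0\<close> on. The result is still bad because the removed heads are related pairwise,
    yet it is shorter at \<open>s 0\<close>, against the minimality of
    \<open>F (s 0)\<close>.\<close>
  define g where "g i = (if i < s 0 then m i else tl (m (s (i - s 0))))" for i
  have "bad g"
    unfolding bad_def
  proof (intro allI impI notI)
    fix i j :: nat
    assume "i < j" and emb: "list_emb P (g i) (g j)"
    consider "j < s 0" | "i < s 0" "s 0 \<le> j" | "s 0 \<le> i" by linarith
    then show False
    proof cases
      case 1
      then show False using emb bad_m \<open>i < j\<close> by (simp add: g_def)
    next
      case 2
      then have "list_emb P (m i) (tl (m (s (j - s 0))))" using emb by (simp add: g_def)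
      then have "list_emb P (m i) (m (s (j - s 0)))" using m_Cons by (metis list_emb_Cons)
      moreover have "s 0 \<le> s (j - s 0)" using s by (simp add: strict_mono_less_eq)
      ultimately show False using bad_m 2 by (meson less_le_trans)
    next
      case 3
      define u v where "u = i - s 0" and "v = j - s 0"
      have uv: "u < v" using 3 \<open>i < j\<close> by (simp add: u_def v_def)
      have "list_emb P (tl (m (s u))) (tl (m (s v)))"
        using emb 3 \<open>i < j\<close> by (simp add: g_def u_def v_def)
      then have "list_emb P (m (s u)) (m (s v))"
        using list_emb_Cons2[where P = P, OF Ps[OF uv]] m_Cons by metis
      then show False using bad_m uv s by (simp add: strict_mono_def)
    qed
  qed
  moreover have "\<forall>i<s 0. g i = F (s 0) i" by (simp add: g_def Fm)
  ultimately have "length (F (s 0) (s 0)) \<le> length (g (s 0))"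
    using F(1)[of "s 0"] by (simp add: least_def)
  then show False using ne[of "s 0"] by (cases "m (s 0)") (simp_all add: g_def Fm)
qed

text \<open>The matching of positions is extended to all of \<open>nat\<close>, as membership in
  \<open>inc\<close> demands. A skipped letter of \<open>ys\<close> composes \<open>p\<close> with
  \<open>Suc\<close>; a matched pair sends 0 to 0 and shifts the rest.\<close>

lemma list_emb_strict_monoE:
  assumes "list_emb P xs ys"
  obtains p :: "nat \<Rightarrow> nat" where "strict_mono p"
    "\<And>j. j < length xs \<Longrightarrow> p j < length ys \<and> P (xs ! j) (ys ! p j)"
proof -
  have "\<exists>p :: nat \<Rightarrow> nat. strict_mono p \<and>
      (\<forall>j<length xs. p j < length ys \<and> P (xs ! j) (ys ! p j))"
    using assms
  proof induction
    case (list_emb_Nil ys)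
    show ?case by (intro exI[of _ "\<lambda>n::nat. n"]) (simp add: strict_mono_def)
  next
    case (list_emb_Cons xs ys y)
    then obtain p where "strict_mono p" "\<forall>j<length xs. p j < length ys \<and> P (xs ! j) (ys ! p j)"
      by blast
    then show ?case by (intro exI[of _ "Suc \<circ> p"]) (simp add: strict_mono_def)
  next
    case (list_emb_Cons2 x y xs ys)
    then obtain p where "strict_mono p" "\<forall>j<length xs. p j < length ys \<and> P (xs ! j) (ys ! p j)"
      by blast
    with \<open>P x y\<close> show ?case
      by (intro exI[of _ "case_nat 0 (Suc \<circ> p)"])
        (auto simp: strict_mono_def nth_Cons split: nat.split)
  qed
  then show ?thesis using that by blast
qed

section \<open>Families of upward closed sets\<close>

definition upset :: "'a set \<Rightarrow> ('a \<Rightarrow> 'a \<Rightarrow> bool) \<Rightarrow> 'a set \<Rightarrow> bool"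
  where "upset V le A \<longleftrightarrow> A \<subseteq> V \<and> (\<forall>v\<in>A. \<forall>w\<in>V. le v w \<longrightarrow> w \<in> A)"

text \<open>This is the ascending chain condition: minimal elements of the relation are maximal
  upsets. Elements \<open>w i\<close> new at each stage of a chain would have a good pair
  \<open>i < j\<close>, and \<open>w j\<close> would already lie in \<open>I j\<close>.\<close>

lemma wf_upsets:
  assumes "\<And>f :: nat \<Rightarrow> 'a. range f \<subseteq> V \<Longrightarrow> \<exists>i j. i < j \<and> le (f i) (f j)"
  shows "wf {(A, B). B \<subset> A \<and> upset V le A \<and> upset V le B}"
  unfolding wf_iff_no_infinite_down_chain
proof
  assume "\<exists>I. \<forall>i. (I (Suc i), I i) \<in> {(A, B). B \<subset> A \<and> upset V le A \<and> upset V le B}"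
  then obtain I where "\<And>i. (I (Suc i), I i) \<in> {(A, B). B \<subset> A \<and> upset V le A \<and> upset V le B}"
    by blast
  then have I: "\<And>i. I i \<subset> I (Suc i)" "\<And>i. upset V le (I i)" by auto
  then have "\<forall>i. \<exists>w. w \<in> I (Suc i) - I i" by blast
  then obtain w where w: "\<And>i. w i \<in> I (Suc i) - I i" by metis
  have V: "range w \<subseteq> V" using w I(2) by (auto simp: upset_def)
  then obtain i j where ij: "i < j" "le (w i) (w j)" using assms by blast
  have "I (Suc i) \<subseteq> I j"
    using lift_Suc_mono_le[of I "Suc i" j, OF psubset_imp_subset[OF I(1)]] ij(1) by simp
  then have "w i \<in> I j" using w by blast
  then have "w j \<in> I j" using I(2)[of j] ij(2) V by (auto simp: upset_def)
  then show False using w by blast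
qed

text \<open>An upset that is maximal among those contained in infinitely many members of \<open>F\<close>
  could be enlarged by an element of \<open>T\<close>.\<close>

lemma finite_upset_family:
  assumes wqo: "\<And>f :: nat \<Rightarrow> 'a. range f \<subseteq> V \<Longrightarrow> \<exists>i j. i < j \<and> le (f i) (f j)"
    and up: "\<And>S. S \<in> F \<Longrightarrow> upset V le S"
    and hit: "\<And>S I. S \<in> F \<Longrightarrow> I \<subset> S \<Longrightarrow>
      \<exists>T. finite T \<and> T \<inter> I = {} \<and> (\<forall>S'\<in>F. T \<inter> S' \<noteq> {})"
  shows "finite F"
proof (rule ccontr)
  let ?Q = "{I. upset V le I \<and> infinite {S \<in> F. I \<subseteq> S}}"
  have wf: "wf {(A, B). B \<subset> A \<and> upset V le A \<and> upset V le B}"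
    using wqo by (rule wf_upsets)
  assume "infinite F"
  then have "{} \<in> ?Q" by (simp add: upset_def)
  then obtain I where I: "I \<in> ?Q"
    and max: "\<And>I'. I \<subset> I' \<Longrightarrow> upset V le I' \<Longrightarrow> I' \<notin> ?Q"
    using wfE_min[OF wf] by (smt (verit) case_prodI mem_Collect_eq)
  from I have inf: "infinite {S \<in> F. I \<subseteq> S}" by simp
  then have "\<not> {S \<in> F. I \<subseteq> S} \<subseteq> {I}" using finite_subset by blast
  then obtain S where "S \<in> F" "I \<subset> S" by blast
  from hit[OF this] obtain T where T: "finite T" "T \<inter> I = {}" "\<forall>S'\<in>F. T \<inter> S' \<noteq> {}" by blast
  have "\<exists>w\<in>T. infinite {S \<in> {S \<in> F. I \<subseteq> S}. w \<in> S}"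
    using T(3) by (intro pigeonhole_infinite_rel inf T(1)) blast
  then obtain w where w: "w \<in> T" "infinite {S \<in> {S \<in> F. I \<subseteq> S}. w \<in> S}" by blast
  \<comment> \<open>The intersection of \<open>G\<close> is the enlargement of \<open>I\<close>: it
    also contains \<open>w\<close>, which is not in \<open>I\<close>, and lies in each of the
    infinitely many members of \<open>G\<close>. Nonemptiness of \<open>G\<close> keeps it inside
    \<open>V\<close>.\<close>
  define G where "G = {S \<in> {S \<in> F. I \<subseteq> S}. w \<in> S}"
  have "G \<noteq> {}" using w(2) unfolding G_def by (metis finite.emptyI)
  then have "upset V le (\<Inter>G)"
    using up unfolding upset_def G_def by blast
  moreover have "I \<subset> \<Inter>G" using T(2) w(1) unfolding G_def by blast
  moreover have "infinite {S \<in> F. \<Inter>G \<subseteq> S}"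
    using w(2) by (rule contrapos_nn, elim finite_subset[rotated]) (auto simp: G_def)
  ultimately show False using max by blast
qed

section \<open>Monomials in finitely many columns\<close>

definition in_columns :: "nat \<Rightarrow> 'c monom \<Rightarrow> bool"
  where "in_columns n m \<longleftrightarrow> (\<forall>(i, j)\<in>Poly_Mapping.keys m. j < n)"

lemma in_columns_lookup: "in_columns n m \<Longrightarrow> n \<le> j \<Longrightarrow> Poly_Mapping.lookup m (i, j) = 0"
  unfolding in_columns_def by (metis case_prodD in_keys_iff not_le)

lemma in_columns_mono: "in_columns n m \<Longrightarrow> n \<le> n' \<Longrightarrow> in_columns n' m"
  unfolding in_columns_def using less_le_trans by blast

lemma ex_in_columns: "\<exists>n. in_columns n m"
proof -
  have "finite (snd ` Poly_Mapping.keys m)" by simp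
  then obtain n where "\<forall>j\<in>snd ` Poly_Mapping.keys m. j < n"
    using finite_nat_set_iff_bounded by blast
  then show ?thesis by (force simp: in_columns_def)
qed

text \<open>A monomial together with a number of columns containing it is a word over the alphabet of
  exponent vectors in \<open>\<nat>\<^sup>c\<close>. Trailing letters may be \<open>0\<close>, so that the length is extra data.\<close>

definition words :: "(nat \<times> 'c monom) set"
  where "words = {(n, m). in_columns n m}"

text \<open>On \<open>words\<close> this says that \<open>p\<close> moves the first monomial to a
  divisor of the second. The bound on \<open>p\<close> makes it carry polynomials in
  \<open>fst v\<close> columns to polynomials in \<open>fst w\<close> columns.\<close>

definition word_le :: "nat \<times> 'c monom \<Rightarrow> nat \<times> 'c monom \<Rightarrow> bool"
  where "word_le v w \<longleftrightarrow> (\<exists>p\<in>inc. (\<forall>j<fst v. p j < fst w) \<and>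
    (\<forall>i. \<forall>j<fst v. Poly_Mapping.lookup (snd v) (i, j) \<le> Poly_Mapping.lookup (snd w) (i, p j)))"

text \<open>Higman's lemma applies over the alphabet of exponent vectors of one column, which
  Dickson's lemma handles because there are finitely many rows.\<close>

lemma word_le_wqo:
  fixes f :: "nat \<Rightarrow> nat \<times> ('c::finite) monom"
  shows "\<exists>i j. i < j \<and> word_le (f i) (f j)"
proof -
  define word where "word = (\<lambda>v :: nat \<times> 'c monom.
    map (\<lambda>j i. Poly_Mapping.lookup (snd v) (i, j)) [0..<fst v])"
  define P where "P = (\<lambda>a b :: 'c \<Rightarrow> nat. \<forall>i. a i \<le> b i)"
  have "\<exists>i j. i < j \<and> list_emb P (word (f i)) (word (f j))"
  proof (rule higman)
    show "\<exists>s :: nat \<Rightarrow> nat. strict_mono s \<and> (\<forall>i j. i < j \<longrightarrow> P (g (s i)) (g (s j)))" for g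
      using dickson[of UNIV g] by (simp add: P_def)
  qed
  then obtain i j where ij: "i < j" and "list_emb P (word (f i)) (word (f j))" by blast
  from list_emb_strict_monoE[OF this(2)] obtain p where p: "strict_mono p"
    "\<And>k. k < length (word (f i)) \<Longrightarrow>
      p k < length (word (f j)) \<and> P (word (f i) ! k) (word (f j) ! p k)"
    by blast
  then have "word_le (f i) (f j)"
    unfolding word_le_def
    by (intro bexI[of _ p] conjI allI impI) (force simp: word_def P_def inc_def)+
  then show ?thesis using ij by blast
qed

text \<open>Only finitely many variables occur, so Dickson's lemma finds in any descending chain an
  earlier monomial dividing a later one; a term order puts a divisor below its multiple.\<close>

lemma wf_term_order_in_columns:
  fixes ord :: "('c::finite) monom rel"
  assumes "term_order ord"
  shows "wf {(a, b). in_columns n a \<and> in_columns n b \<and> (a, b) \<in> ord \<and> a \<noteq> b}"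
  unfolding wf_iff_no_infinite_down_chain
proof
  let ?r = "{(a, b). in_columns n a \<and> in_columns n b \<and> (a, b) \<in> ord \<and> a \<noteq> b}"
  from assms have ord: "trans ord" "antisym ord"
    and mult: "\<And>f g h. (f, g) \<in> ord \<Longrightarrow> (f + h, g + h) \<in> ord" and zero: "\<And>f. (0, f) \<in> ord"
    by (auto simp: term_order_def linear_order_on_def partial_order_on_def preorder_on_def)
  assume "\<exists>f. \<forall>i. (f (Suc i), f i) \<in> ?r"
  then obtain f where f: "\<And>i. (f (Suc i), f i) \<in> ?r" by blast
  have "(f (i + Suc k), f i) \<in> ord" for i k
  proof (induction k)
    case (Suc k)
    then show ?case using f[of "i + Suc k"] transD[OF ord(1)] by auto
  qed (use f in auto)
  then have desc: "(f j, f i) \<in> ord" if "i < j" for i j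
    using that less_imp_Suc_add[of i j] by auto
  have "finite (UNIV \<times> {..<n} :: ('c \<times> nat) set)" by simp
  from dickson[OF this, of "\<lambda>i. Poly_Mapping.lookup (f i)"]
  obtain s :: "nat \<Rightarrow> nat" where s: "strict_mono s"
    and le: "\<And>i j x. i < j \<Longrightarrow> x \<in> UNIV \<times> {..<n} \<Longrightarrow>
      Poly_Mapping.lookup (f (s i)) x \<le> Poly_Mapping.lookup (f (s j)) x"
    by metis
  \<comment> \<open>Subtraction of exponents is truncated, so this equation expresses divisibility.
    From column \<open>n\<close> on, the exponents of \<open>f (s 0)\<close> are 0.\<close>
  have "f (s 1) = f (s 0) + (f (s 1) - f (s 0))"
  proof (rule poly_mapping_eqI)
    fix x :: "'c \<times> nat"
    have "Poly_Mapping.lookup (f (s 0)) x \<le> Poly_Mapping.lookup (f (s 1)) x"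
    proof (cases "snd x < n")
      case True
      then show ?thesis using le[of 0 1 x] by (simp add: mem_Times_iff)
    next
      case False
      then show ?thesis using in_columns_lookup[of n "f (s 0)" "snd x" "fst x"] f[of "s 0"] by simp
    qed
    then show "Poly_Mapping.lookup (f (s 1)) x
        = Poly_Mapping.lookup (f (s 0) + (f (s 1) - f (s 0))) x"
      by (simp add: lookup_add lookup_minus)
  qed
  then have up: "(f (s 0), f (s 1)) \<in> ord"
    using mult[OF zero, of "f (s 0)" "f (s 1) - f (s 0)"] by (simp add: add.commute)
  have "s 0 < s 1" using s by (simp add: strict_mono_def)
  \<comment> \<open>\<open>desc\<close> is a weak comparison; strictness is known for single steps,
    so the contradiction is sought at the step from \<open>s 0\<close> to its successor.\<close>
  then have "(f (s 1), f (Suc (s 0))) \<in> ord"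
  proof (cases "s 1 = Suc (s 0)")
    case True
    then show ?thesis using assms
      by (simp add: term_order_def linear_order_on_def partial_order_on_def preorder_on_def refl_on_def)
  qed (use desc in simp)
  with up have "(f (s 0), f (Suc (s 0))) \<in> ord" using transD[OF ord(1)] by blast
  then show False using f[of "s 0"] antisymD[OF ord(2)] by auto
qed

section \<open>The action on monomials and polynomials\<close>

text \<open>An injective relabelling merges no terms. The action on monomials and on polynomials,
  multiplication by a monomial and, with the identity, the expansion into terms all have this
  form.\<close>

lemma
  fixes f :: "'a \<Rightarrow>\<^sub>0 'b::comm_monoid_add" and \<phi> :: "'a \<Rightarrow> 'd"
  defines "g \<equiv> \<Sum>m\<in>Poly_Mapping.keys f. Poly_Mapping.single (\<phi> m) (Poly_Mapping.lookup f m)"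
  assumes inj: "inj \<phi>"
  shows lookup_reindex: "Poly_Mapping.lookup g (\<phi> m) = Poly_Mapping.lookup f m"
    and keys_reindex: "Poly_Mapping.keys g = \<phi> ` Poly_Mapping.keys f"
proof -
  have *: "Poly_Mapping.lookup g x
      = (\<Sum>k\<in>Poly_Mapping.keys f. Poly_Mapping.lookup f k when \<phi> k = x)" for x
    by (simp add: g_def lookup_sum lookup_single)
  show 1: "Poly_Mapping.lookup g (\<phi> m) = Poly_Mapping.lookup f m" for m
    unfolding * using inj by (auto simp: when_def inj_eq in_keys_iff)
  have range: "x \<in> range \<phi>" if "Poly_Mapping.lookup g x \<noteq> 0" for x
  proof -
    obtain k where "(Poly_Mapping.lookup f k when \<phi> k = x) \<noteq> 0"
      using \<open>Poly_Mapping.lookup g x \<noteq> 0\<close>[unfolded *]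
      by (rule sum.not_neutral_contains_not_neutral)
    then show ?thesis by auto
  qed
  show "Poly_Mapping.keys g = \<phi> ` Poly_Mapping.keys f"
  proof (intro equalityI subsetI)
    fix x assume x: "x \<in> Poly_Mapping.keys g"
    then obtain k where "x = \<phi> k" using range by (auto simp: in_keys_iff)
    then show "x \<in> \<phi> ` Poly_Mapping.keys f" using x 1[of k] by (simp add: in_keys_iff)
  next
    fix x assume "x \<in> \<phi> ` Poly_Mapping.keys f"
    then show "x \<in> Poly_Mapping.keys g" using 1 by (auto simp: in_keys_iff)
  qed
qed

lemma poly_mapping_sum_single:
  "f = (\<Sum>m\<in>Poly_Mapping.keys f. Poly_Mapping.single m (Poly_Mapping.lookup f m))"
  using lookup_reindex[of "\<lambda>x. x" f] by (intro poly_mapping_eqI) simp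

lemma keys_times_monom:
  fixes f :: "('c, 'k::comm_ring_1) poly_ring"
  shows "Poly_Mapping.keys (Poly_Mapping.single h 1 * f) = (\<lambda>m. m + h) ` Poly_Mapping.keys f"
proof -
  have "Poly_Mapping.single h 1 * f = Poly_Mapping.single h 1 *
      (\<Sum>m\<in>Poly_Mapping.keys f. Poly_Mapping.single m (Poly_Mapping.lookup f m))"
    using poly_mapping_sum_single[of f] by simp
  also have "\<dots> = (\<Sum>m\<in>Poly_Mapping.keys f. Poly_Mapping.single (m + h) (Poly_Mapping.lookup f m))"
    by (simp add: sum_distrib_left mult_single add.commute)
  finally show ?thesis by (simp add: keys_reindex inj_def)
qed

lemma inj_column_map: "p \<in> inc \<Longrightarrow> inj (\<lambda>(i, j). (i, p j))"
  by (auto simp: inj_def inc_def strict_mono_eq)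

lemma inc_monom_eq:
  "inc_monom p m = (\<Sum>x\<in>Poly_Mapping.keys m.
    Poly_Mapping.single ((\<lambda>(i, j). (i, p j)) x) (Poly_Mapping.lookup m x))"
  unfolding inc_monom_def by (rule sum.cong) auto

lemma lookup_inc_monom:
  "p \<in> inc \<Longrightarrow> Poly_Mapping.lookup (inc_monom p m) (i, p j) = Poly_Mapping.lookup m (i, j)"
  using lookup_reindex[OF inj_column_map, of p m "(i, j)"] by (simp add: inc_monom_eq)

lemma keys_inc_monom:
  "p \<in> inc \<Longrightarrow> Poly_Mapping.keys (inc_monom p m) = (\<lambda>(i, j). (i, p j)) ` Poly_Mapping.keys m"
  by (simp add: inc_monom_eq keys_reindex inj_column_map)

lemma inj_inc_monom: "p \<in> inc \<Longrightarrow> inj (inc_monom p)"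
proof (rule injI)
  fix a b :: "'c monom"
  assume p: "p \<in> inc" and eq: "inc_monom p a = inc_monom p b"
  have "Poly_Mapping.lookup a (i, j) = Poly_Mapping.lookup b (i, j)" for i j
    using lookup_inc_monom[OF p] eq by metis
  then show "a = b" by (intro poly_mapping_eqI) auto
qed

lemma keys_inc_poly:
  "p \<in> inc \<Longrightarrow> Poly_Mapping.keys (inc_poly p f) = inc_monom p ` Poly_Mapping.keys f"
  by (simp add: inc_poly_def keys_reindex inj_inc_monom)

lemma in_columns_add: "in_columns n a \<Longrightarrow> in_columns n b \<Longrightarrow> in_columns n (a + b)"
  using keys_add[of a b] unfolding in_columns_def by blast

lemma in_columns_inc_monom:
  "p \<in> inc \<Longrightarrow> in_columns n m \<Longrightarrow> \<forall>j<n. p j < n' \<Longrightarrow> in_columns n' (inc_monom p m)"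
  by (auto simp: in_columns_def keys_inc_monom)

lemma word_leE:
  assumes "word_le (n, a) (n', b)" "in_columns n a" "in_columns n' b"
  obtains p h where "p \<in> inc" "\<forall>j<n. p j < n'" "in_columns n' h" "b = inc_monom p a + h"
proof -
  obtain p where p: "p \<in> inc" "\<forall>j<n. p j < n'"
    and le: "\<And>i j. j < n \<Longrightarrow> Poly_Mapping.lookup a (i, j) \<le> Poly_Mapping.lookup b (i, p j)"
    using assms(1) by (auto simp: word_le_def)
  have le': "Poly_Mapping.lookup (inc_monom p a) x \<le> Poly_Mapping.lookup b x" for x
  proof (cases "x \<in> Poly_Mapping.keys (inc_monom p a)")
    case True
    then obtain i j where "(i, j) \<in> Poly_Mapping.keys a" "x = (i, p j)"
      using p(1) by (auto simp: keys_inc_monom)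
    then show ?thesis
      using le[of j i] assms(2) p(1) by (auto simp: in_columns_def lookup_inc_monom)
  qed (simp add: in_keys_iff)
  show ?thesis
  proof (rule that[OF p])
    show "in_columns n' (b - inc_monom p a)"
      using assms(3) by (auto simp: in_columns_def in_keys_iff lookup_minus)
    show "b = inc_monom p a + (b - inc_monom p a)"
      by (rule poly_mapping_eqI) (simp add: lookup_add lookup_minus le')
  qed
qed

section \<open>Leading words\<close>

text \<open>A relational form of \<open>leading_monom\<close>, whose definite description is usable
  only after existence and uniqueness are known.\<close>

definition is_leading :: "'c monom rel \<Rightarrow> ('c, 'k::zero) poly_ring \<Rightarrow> 'c monom \<Rightarrow> bool"
  where "is_leading ord f m \<longleftrightarrow>
    m \<in> Poly_Mapping.keys f \<and> (\<forall>n\<in>Poly_Mapping.keys f. (n, m) \<in> ord)"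

lemma is_leading_leading_monom:
  fixes f :: "('c, 'k::comm_ring_1) poly_ring"
  assumes ord: "term_order ord" and "f \<noteq> 0"
  shows "is_leading ord f (leading_monom ord f)"
proof -
  have lin: "refl ord" "antisym ord" "trans ord" "total ord"
    using ord by (auto simp: term_order_def linear_order_on_def partial_order_on_def preorder_on_def)
  have "\<exists>m\<in>A. \<forall>n\<in>A. (n, m) \<in> ord" if "finite A" "A \<noteq> {}" for A
    using that
  proof (induction rule: finite_ne_induct)
    case (singleton x)
    then show ?case using lin(1) by (auto simp: refl_on_def)
  next
    case (insert x A)
    then obtain m where m: "m \<in> A" "\<forall>n\<in>A. (n, m) \<in> ord" by blast
    have "(x, m) \<in> ord \<or> (m, x) \<in> ord"
      using lin(1,4) by (metis UNIV_I refl_on_def total_on_def)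
    then show ?case
      using m lin(1) transD[OF lin(3)] by (metis UNIV_I insert_iff refl_on_def)
  qed
  moreover have "Poly_Mapping.keys f \<noteq> {}" using \<open>f \<noteq> 0\<close> by simp
  ultimately obtain m where m: "is_leading ord f m" unfolding is_leading_def by (metis finite_keys)
  moreover have "n = m" if "is_leading ord f n" for n
    using that m antisymD[OF lin(2)] unfolding is_leading_def by blast
  ultimately show ?thesis
    unfolding leading_monom_def is_leading_def[symmetric] by (rule theI)
qed

text \<open>The number \<open>n\<close> bounds the columns of all of \<open>f\<close>: a polynomial
  can have its leading monomial in the first \<open>n\<close> columns and other monomials
  outside.\<close>

definition lead_words :: "('c, 'k::zero) poly_ring set \<Rightarrow> 'c monom rel \<Rightarrow> (nat \<times> 'c monom) set"
  where "lead_words J ord = {(n, m).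
    \<exists>f\<in>J. (\<forall>k\<in>Poly_Mapping.keys f. in_columns n k) \<and> is_leading ord f m}"

text \<open>Every polynomial involves finitely many columns, so forgetting \<open>n\<close> recovers
  all leading monomials of \<open>J\<close>.\<close>

lemma initial_ideal_lead_words:
  fixes J :: "('c, 'k::comm_ring_1) poly_ring set"
  assumes ord: "term_order ord"
  shows "initial_ideal ord J
    = ideal_generated ((\<lambda>m. Poly_Mapping.single m 1) ` snd ` lead_words J ord)"
proof -
  have uniq: "m = leading_monom ord f" if "is_leading ord f m" for f :: "('c, 'k) poly_ring" and m
  proof -
    have "f \<noteq> 0" using that by (auto simp: is_leading_def)
    then show ?thesis
      using is_leading_leading_monom[OF ord, of f] that ord
      by (auto simp: is_leading_def term_order_def linear_order_on_def partial_order_on_def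
          dest: antisymD)
  qed
  have ex: "\<exists>n. \<forall>k\<in>Poly_Mapping.keys f. in_columns n k" for f :: "('c, 'k) poly_ring"
  proof -
    obtain N where N: "\<And>k :: 'c monom. in_columns (N k) k" using ex_in_columns by metis
    have "in_columns (Max (N ` Poly_Mapping.keys f)) k" if "k \<in> Poly_Mapping.keys f" for k
      using that by (intro in_columns_mono[OF N]) simp
    then show ?thesis by blast
  qed
  have "{Poly_Mapping.single (leading_monom ord f) (1::'k) | f. f \<in> J \<and> f \<noteq> 0}
      = (\<lambda>m. Poly_Mapping.single m 1) ` snd ` lead_words J ord" (is "?L = ?R")
  proof
    show "?L \<subseteq> ?R"
    proof
      fix x assume "x \<in> ?L"
      then obtain f where f: "f \<in> J" "f \<noteq> 0" "x = Poly_Mapping.single (leading_monom ord f) 1"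
        by blast
      obtain n where "\<forall>k\<in>Poly_Mapping.keys f. in_columns n k" using ex by blast
      then have "(n, leading_monom ord f) \<in> lead_words J ord"
        using f is_leading_leading_monom[OF ord] by (auto simp: lead_words_def)
      then show "x \<in> ?R" unfolding f(3) by force
    qed
    show "?R \<subseteq> ?L"
      using uniq by (fastforce simp: lead_words_def is_leading_def)
  qed
  then show ?thesis by (simp add: initial_ideal_def)
qed

text \<open>If \<open>f\<close> witnesses \<open>(n, a)\<close>, then \<open>p\<close> applied to
  \<open>f\<close>, times the monomial \<open>h\<close>, witnesses
  \<open>(n', inc_monom p a + h)\<close>: compatibility and multiplicativity of the order keep the
  leading monomial leading.\<close>

lemma upset_lead_words:
  fixes J :: "('c, 'k::comm_ring_1) poly_ring set"
  assumes J: "is_ideal J" and inv: "{inc_poly p f | p f. p \<in> inc \<and> f \<in> J} \<subseteq> J"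
    and ord: "term_order ord" "inc_compatible ord"
  shows "upset words word_le (lead_words J ord)"
  unfolding upset_def
proof (intro conjI ballI impI)
  show sub: "lead_words J ord \<subseteq> words"
    by (auto simp: lead_words_def words_def is_leading_def)
  fix v w assume v: "v \<in> lead_words J ord" and w: "w \<in> words" and le: "word_le v w"
  obtain n a n' b where vw: "v = (n, a)" "w = (n', b)" by (metis surj_pair)
  have "in_columns n a" "in_columns n' b" using v w sub by (auto simp: vw words_def)
  from word_leE[OF le[unfolded vw] this] obtain p h
    where p: "p \<in> inc" "\<forall>j<n. p j < n'" and h: "in_columns n' h" and b: "b = inc_monom p a + h"
    by metis
  from v obtain f where f: "f \<in> J" "\<forall>k\<in>Poly_Mapping.keys f. in_columns n k" "is_leading ord f a"
    by (auto simp: lead_words_def vw)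
  define g where "g = Poly_Mapping.single h 1 * inc_poly p f"
  have keys: "Poly_Mapping.keys g = (\<lambda>m. inc_monom p m + h) ` Poly_Mapping.keys f"
    by (simp add: g_def keys_times_monom keys_inc_poly p(1) image_image)
  have "inc_poly p f \<in> J" using inv f(1) p(1) by blast
  then have "g \<in> J" unfolding g_def by (rule module.subspace_scale[OF module_times J])
  moreover have "\<forall>k\<in>Poly_Mapping.keys g. in_columns n' k"
    using f(2) p h by (auto simp: keys intro!: in_columns_add in_columns_inc_monom)
  moreover have "is_leading ord g b"
    using f(3) ord p(1)
    by (auto simp: is_leading_def keys b inc_compatible_def term_order_def)
  ultimately show "w \<in> lead_words J ord" by (auto simp: lead_words_def vw)
qed

text \<open>Division with remainder by well-founded induction on \<open>m\<close>: a leading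
  monomial is traded for strictly smaller ones in the same columns.\<close>

lemma normal_form:
  fixes J :: "('c::finite, 'k::field) poly_ring set"
  assumes J: "is_ideal J" and ord: "term_order ord" and "in_columns n m"
  shows "\<exists>g. Poly_Mapping.single m 1 - g \<in> J \<and>
    (\<forall>k\<in>Poly_Mapping.keys g. in_columns n k \<and> (n, k) \<notin> lead_words J ord)"
  using wf_term_order_in_columns[OF ord, of n] \<open>in_columns n m\<close>
proof (induction m rule: wf_induct_rule)
  case (less m)
  show ?case
  proof (cases "(n, m) \<in> lead_words J ord")
    case False
    then show ?thesis
      using less.prems module.subspace_0[OF module_times J]
      by (intro exI[of _ "Poly_Mapping.single m 1"]) simp
  next
    case True
    then obtain f where f: "f \<in> J" "\<forall>k\<in>Poly_Mapping.keys f. in_columns n k" "is_leading ord f m"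
      by (auto simp: lead_words_def)
    define c where "c = Poly_Mapping.lookup f m"
    have c: "c \<noteq> 0" using f(3) by (simp add: c_def is_leading_def in_keys_iff)
    define K where "K = Poly_Mapping.keys f - {m}"
    have "\<exists>g. Poly_Mapping.single k 1 - g \<in> J \<and>
        (\<forall>k\<in>Poly_Mapping.keys g. in_columns n k \<and> (n, k) \<notin> lead_words J ord)" if "k \<in> K" for k
      using that f(2,3) less.prems by (intro less.IH) (auto simp: K_def is_leading_def)
    then obtain N where N: "\<And>k. k \<in> K \<Longrightarrow> Poly_Mapping.single k 1 - N k \<in> J"
      and N_keys: "\<And>k l. k \<in> K \<Longrightarrow> l \<in> Poly_Mapping.keys (N k) \<Longrightarrow>
        in_columns n l \<and> (n, l) \<notin> lead_words J ord"
      by metis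
    let ?s = "\<lambda>a. Poly_Mapping.single (0 :: 'c monom) (a :: 'k)"
    \<comment> \<open>Solving \<open>f\<close> for its leading term writes \<open>m\<close> modulo
      \<open>J\<close> as a combination of the monomials in \<open>K\<close>, with these
      coefficients; each is replaced by its normal form.\<close>
    define g where "g = (\<Sum>k\<in>K. ?s (- Poly_Mapping.lookup f k / c) * N k)"
    have "f = (\<Sum>k\<in>Poly_Mapping.keys f. Poly_Mapping.single k (Poly_Mapping.lookup f k))"
      by (rule poly_mapping_sum_single)
    also have "\<dots> = Poly_Mapping.single m c
        + (\<Sum>k\<in>K. Poly_Mapping.single k (Poly_Mapping.lookup f k))"
      using f(3) by (subst sum.remove[of _ m]) (auto simp: K_def c_def is_leading_def)
    finally have f_eq: "f = \<dots>" .
    have "?s (1 / c) * f = Poly_Mapping.single m 1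
        + (\<Sum>k\<in>K. Poly_Mapping.single k (Poly_Mapping.lookup f k / c))"
      by (subst f_eq) (simp add: distrib_left sum_distrib_left mult_single c)
    then have m_eq: "Poly_Mapping.single m 1 = ?s (1 / c) * f
        + (\<Sum>k\<in>K. ?s (- Poly_Mapping.lookup f k / c) * Poly_Mapping.single k 1)"
      by (simp add: mult_single single_uminus sum_negf)
    have "Poly_Mapping.single m 1 - g = ?s (1 / c) * f
        + (\<Sum>k\<in>K. ?s (- Poly_Mapping.lookup f k / c) * (Poly_Mapping.single k 1 - N k))"
      unfolding m_eq g_def by (simp add: right_diff_distrib sum_subtractf)
    also have "\<dots> \<in> J"
      using f(1) N
      by (intro module.subspace_add[OF module_times J] module.subspace_sum[OF module_times J]
          module.subspace_scale[OF module_times J])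
    finally have "Poly_Mapping.single m 1 - g \<in> J" .
    moreover have "in_columns n k \<and> (n, k) \<notin> lead_words J ord"
      if k: "k \<in> Poly_Mapping.keys g" for k
    proof -
      have "(\<Sum>l\<in>K. Poly_Mapping.lookup (?s (- Poly_Mapping.lookup f l / c) * N l) k) \<noteq> 0"
        using k by (simp add: g_def in_keys_iff lookup_sum)
      then obtain l where l: "l \<in> K"
        and "k \<in> Poly_Mapping.keys (?s (- Poly_Mapping.lookup f l / c) * N l)"
        by (auto simp: in_keys_iff elim: sum.not_neutral_contains_not_neutral)
      then have "k \<in> Poly_Mapping.keys (N l)"
        using keys_mult[of "?s (- Poly_Mapping.lookup f l / c)" "N l"] by (auto split: if_splits)
      then show ?thesis using N_keys l by blast
    qed
    ultimately show ?thesis by blast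
  qed
qed

theorem corollary3p18:
  fixes J :: "('c::finite, 'k::field) poly_ring set"
  assumes "is_ideal J"
    and "{inc_poly p f | p f. p \<in> inc \<and> f \<in> J} \<subseteq> J"
  shows "finite {initial_ideal ord J | ord. term_order ord \<and> inc_compatible ord}"
proof -
  define F where "F = lead_words J ` {ord. term_order ord \<and> inc_compatible ord}"
  have "finite F"
  proof (rule finite_upset_family)
    show "\<exists>i j. i < j \<and> word_le (f i) (f j)" for f :: "nat \<Rightarrow> nat \<times> 'c monom"
      by (rule word_le_wqo)
    show "upset words word_le S" if "S \<in> F" for S
      using that upset_lead_words[OF assms] by (auto simp: F_def)
    fix S I assume "S \<in> F" "I \<subset> S"
    then obtain ord n m where ord: "term_order ord" "S = lead_words J ord"
      and m: "(n, m) \<in> lead_words J ord" "(n, m) \<notin> I"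
      by (auto simp: F_def)
    have "in_columns n m" using m by (auto simp: lead_words_def is_leading_def)
    from normal_form[OF assms(1) ord(1) this] obtain g
      where g: "Poly_Mapping.single m 1 - g \<in> J"
      and g_keys: "\<And>k. k \<in> Poly_Mapping.keys g \<Longrightarrow> in_columns n k \<and> (n, k) \<notin> lead_words J ord"
      by blast
    define f where "f = Poly_Mapping.single m 1 - g"
    have f_keys: "Poly_Mapping.keys f \<subseteq> insert m (Poly_Mapping.keys g)"
      by (auto simp: f_def in_keys_iff lookup_minus lookup_single when_def split: if_splits)
    \<comment> \<open>The word \<open>(n, m)\<close> is leading and no monomial of \<open>g\<close>
      gives a leading word, so \<open>m\<close> is not cancelled.\<close>
    have "Poly_Mapping.lookup f m = 1"
      using m(1) g_keys[of m] by (auto simp: f_def lookup_minus in_keys_iff)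
    then have "f \<noteq> 0" by auto
    \<comment> \<open>Monomials of \<open>g\<close> give words outside \<open>S\<close>, hence
      outside \<open>I\<close>, and \<open>(n, m)\<close> was chosen outside \<open>I\<close>. The
      choice of \<open>f\<close> depends on \<open>ord\<close>, but under any other order too the
      nonzero \<open>f\<close> has a leading monomial among its keys.\<close>
    let ?T = "Pair n ` Poly_Mapping.keys f"
    have "?T \<inter> I = {}" using f_keys g_keys m(2) \<open>I \<subset> S\<close> ord(2) by blast
    moreover have "?T \<inter> S' \<noteq> {}" if "S' \<in> F" for S'
    proof -
      obtain ord' where "term_order ord'" and S': "S' = lead_words J ord'"
        using \<open>S' \<in> F\<close> by (auto simp: F_def)
      then have lead: "is_leading ord' f (leading_monom ord' f)"
        using \<open>f \<noteq> 0\<close> by (intro is_leading_leading_monom)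
      moreover have "\<forall>k\<in>Poly_Mapping.keys f. in_columns n k"
        using f_keys g_keys \<open>in_columns n m\<close> by blast
      ultimately have "(n, leading_monom ord' f) \<in> S'"
        using g by (auto simp: S' lead_words_def f_def)
      then show ?thesis using lead by (auto simp: is_leading_def)
    qed
    ultimately show "\<exists>T. finite T \<and> T \<inter> I = {} \<and> (\<forall>S'\<in>F. T \<inter> S' \<noteq> {})"
      by (intro exI[of _ ?T]) simp
  qed
  \<comment> \<open>An initial ideal depends on the order only through the leading words, so
    finiteness passes from \<open>F\<close> to the ideals.\<close>
  moreover have "{initial_ideal ord J | ord. term_order ord \<and> inc_compatible ord}
      \<subseteq> (\<lambda>L. ideal_generated ((\<lambda>m. Poly_Mapping.single m 1) ` snd ` L)) ` F"
    using initial_ideal_lead_words[of _ J] by (auto simp: F_def)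
  ultimately show ?thesis using finite_surj by blast
qed

end
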